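(* Let $\mathcal E$ be a small category, $\mathcal B$ a category and $p:\mathcal E\to\mathcal B$ a functor. Suppose $p$ admits a representable behavior-code factorization, i.e. there are a functor $C:\mathcal B\to[\mathcal E^{\mathrm{op}},\mathbf{Set}]$ and a natural isomorphism $\alpha:y_{\mathcal E}\Rightarrow C\circ p$, where $y_{\mathcal E}:\mathcal E\to[\mathcal E^{\mathrm{op}},\mathbf{Set}]$ is the Yoneda embedding. Then: (i) $p$ is faithful; (ii) if $p(e)\cong p(e')$ in $\mathcal B$, then $e\cong e'$ in $\mathcal E$. In particular, two nonisomorphic objects of $\mathcal E$ cannot have the same image under $p$.
   Context: In the paper's terminology objects of $\mathcal E$ are proof realizations, objects of $\mathcal B$ are behaviors, and $p$ assigns to a realization its behavior. *)

theory Defs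
  imports Main "HOL-Library.FuncSet"
begin

section \<open>Categories and functors\<close>

record ('o, 'm) category =
  Obj :: "'o set"
  Arr :: "'m set"
  Dom :: "'m \<Rightarrow> 'o"
  Cod :: "'m \<Rightarrow> 'o"
  Ident :: "'o \<Rightarrow> 'm"
  Comp :: "'m \<Rightarrow> 'm \<Rightarrow> 'm"  \<comment> \<open>\<open>Comp C g f\<close> is \<open>g\<close> after \<open>f\<close>\<close>

definition hom :: "('o, 'm) category \<Rightarrow> 'o \<Rightarrow> 'o \<Rightarrow> 'm set" where
  "hom C x y = {f \<in> Arr C. Dom C f = x \<and> Cod C f = y}"

locale category =
  fixes C :: "('o, 'm) category"
  assumes Dom_in_Obj: "f \<in> Arr C \<Longrightarrow> Dom C f \<in> Obj C"
    and Cod_in_Obj: "f \<in> Arr C \<Longrightarrow> Cod C f \<in> Obj C"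
    and Ident_in_hom: "x \<in> Obj C \<Longrightarrow> Ident C x \<in> hom C x x"
    and Comp_in_hom: "\<lbrakk>f \<in> hom C x y; g \<in> hom C y z\<rbrakk> \<Longrightarrow> Comp C g f \<in> hom C x z"
    and Comp_Ident_right: "f \<in> hom C x y \<Longrightarrow> Comp C f (Ident C x) = f"
    and Comp_Ident_left: "f \<in> hom C x y \<Longrightarrow> Comp C (Ident C y) f = f"
    and Comp_assoc: "\<lbrakk>f \<in> hom C w x; g \<in> hom C x y; h \<in> hom C y z\<rbrakk>
      \<Longrightarrow> Comp C h (Comp C g f) = Comp C (Comp C h g) f"

definition iso_in :: "('o, 'm) category \<Rightarrow> 'o \<Rightarrow> 'o \<Rightarrow> 'm \<Rightarrow> bool" where
  "iso_in C x y f \<longleftrightarrow> f \<in> hom C x y \<and>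
     (\<exists>g \<in> hom C y x. Comp C g f = Ident C x \<and> Comp C f g = Ident C y)"

definition isomorphic :: "('o, 'm) category \<Rightarrow> 'o \<Rightarrow> 'o \<Rightarrow> bool" where
  "isomorphic C x y \<longleftrightarrow> x \<in> Obj C \<and> y \<in> Obj C \<and> (\<exists>f. iso_in C x y f)"

definition op_cat :: "('o, 'm) category \<Rightarrow> ('o, 'm) category" where
  "op_cat C = \<lparr>Obj = Obj C, Arr = Arr C, Dom = Cod C, Cod = Dom C,
     Ident = Ident C, Comp = (\<lambda>g f. Comp C f g)\<rparr>"

record ('o, 'm, 'p, 'n) func =
  omap :: "'o \<Rightarrow> 'p"
  amap :: "'m \<Rightarrow> 'n"

definition is_functor ::
    "('o, 'm) category \<Rightarrow> ('p, 'n) category \<Rightarrow> ('o, 'm, 'p, 'n) func \<Rightarrow> bool" where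
  "is_functor C D F \<longleftrightarrow>
     (\<forall>x \<in> Obj C. omap F x \<in> Obj D) \<and>
     (\<forall>f \<in> Arr C. amap F f \<in> hom D (omap F (Dom C f)) (omap F (Cod C f))) \<and>
     (\<forall>x \<in> Obj C. amap F (Ident C x) = Ident D (omap F x)) \<and>
     (\<forall>f \<in> Arr C. \<forall>g \<in> Arr C. Dom C g = Cod C f \<longrightarrow>
        amap F (Comp C g f) = Comp D (amap F g) (amap F f))"

definition func_comp ::
    "('p, 'n, 'q, 'k) func \<Rightarrow> ('o, 'm, 'p, 'n) func \<Rightarrow> ('o, 'm, 'q, 'k) func" where
  "func_comp G F = \<lparr>omap = omap G \<circ> omap F, amap = amap G \<circ> amap F\<rparr>"

definition faithful :: "('o, 'm) category \<Rightarrow> ('o, 'm, 'p, 'n) func \<Rightarrow> bool" where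
  "faithful C F \<longleftrightarrow> (\<forall>x \<in> Obj C. \<forall>y \<in> Obj C. inj_on (amap F) (hom C x y))"

definition natural_transformation ::
    "('o, 'm) category \<Rightarrow> ('p, 'n) category \<Rightarrow>
     ('o, 'm, 'p, 'n) func \<Rightarrow> ('o, 'm, 'p, 'n) func \<Rightarrow> ('o \<Rightarrow> 'n) \<Rightarrow> bool" where
  "natural_transformation C D F G \<eta> \<longleftrightarrow>
     (\<forall>x \<in> Obj C. \<eta> x \<in> hom D (omap F x) (omap G x)) \<and>
     (\<forall>f \<in> Arr C. Comp D (amap G f) (\<eta> (Dom C f)) = Comp D (\<eta> (Cod C f)) (amap F f))"

definition natural_isomorphism ::
    "('o, 'm) category \<Rightarrow> ('p, 'n) category \<Rightarrow>
     ('o, 'm, 'p, 'n) func \<Rightarrow> ('o, 'm, 'p, 'n) func \<Rightarrow> ('o \<Rightarrow> 'n) \<Rightarrow> bool" where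
  "natural_isomorphism C D F G \<eta> \<longleftrightarrow> natural_transformation C D F G \<eta> \<and>
     (\<forall>x \<in> Obj C. iso_in D (omap F x) (omap G x) (\<eta> x))"


section \<open>Sets, functor categories, presheaves\<close>

text \<open>In the categories of sets and of functors the underlying map does not determine source
  and target, so arrows carry them explicitly. The maps are extensional (\<open>undefined\<close> off their
  domain), which makes HOL equality of arrows agree with the mathematical one.\<close>

datatype ('o, 'f) morph = Morph (msrc: 'o) (mmap: 'f) (mtgt: 'o)

text \<open>The type \<open>'u\<close> plays the role of the set-theoretic universe.\<close>

definition set_cat :: "('u set, ('u set, 'u \<Rightarrow> 'u) morph) category" where
  "set_cat = \<lparr>Obj = UNIV,
     Arr = {m. mmap m \<in> msrc m \<rightarrow>\<^sub>E mtgt m},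
     Dom = msrc, Cod = mtgt,
     Ident = (\<lambda>A. Morph A (\<lambda>a \<in> A. a) A),
     Comp = (\<lambda>n m. Morph (msrc m) (compose (msrc m) (mmap n) (mmap m)) (mtgt n))\<rparr>"

definition functor_cat ::
    "('o, 'm) category \<Rightarrow> ('p, 'n) category \<Rightarrow>
     (('o, 'm, 'p, 'n) func, (('o, 'm, 'p, 'n) func, 'o \<Rightarrow> 'n) morph) category" where
  "functor_cat C D =
    (let Fs = {F. is_functor C D F \<and> omap F \<in> extensional (Obj C) \<and> amap F \<in> extensional (Arr C)}
     in \<lparr>Obj = Fs,
       Arr = {m. msrc m \<in> Fs \<and> mtgt m \<in> Fs \<and> mmap m \<in> extensional (Obj C) \<and>
                 natural_transformation C D (msrc m) (mtgt m) (mmap m)},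
       Dom = msrc, Cod = mtgt,
       Ident = (\<lambda>F. Morph F (\<lambda>x \<in> Obj C. Ident D (omap F x)) F),
       Comp = (\<lambda>n m. Morph (msrc m) (\<lambda>x \<in> Obj C. Comp D (mmap n x) (mmap m x)) (mtgt n))\<rparr>)"

type_synonym ('o, 'm, 'u) presheaf = "('o, 'm, 'u set, ('u set, 'u \<Rightarrow> 'u) morph) func"

type_synonym ('o, 'm, 'u) presheaf_arrow =
  "(('o, 'm, 'u) presheaf, 'o \<Rightarrow> ('u set, 'u \<Rightarrow> 'u) morph) morph"

definition presheaf_cat ::
    "('o, 'm) category \<Rightarrow> (('o, 'm, 'u) presheaf, ('o, 'm, 'u) presheaf_arrow) category" where
  "presheaf_cat C = functor_cat (op_cat C) set_cat"


section \<open>Small categories and the Yoneda embedding\<close>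

text \<open>Smallness is relative to the universe \<open>'u\<close>: the arrows, and hence (via identities) also the
  objects, can be encoded injectively as elements of \<open>'u\<close>. The encoding \<open>\<iota>\<close> turns the hom-sets of
  \<open>C\<close> into objects of \<open>set_cat\<close>; if \<open>'u\<close> is the arrow type itself, \<open>\<iota>\<close> can be the identity.\<close>

definition small_category :: "('m \<Rightarrow> 'u) \<Rightarrow> ('o, 'm) category \<Rightarrow> bool" where
  "small_category \<iota> C \<longleftrightarrow> category C \<and> inj_on \<iota> (Arr C)"

definition hom_set :: "('m \<Rightarrow> 'u) \<Rightarrow> ('o, 'm) category \<Rightarrow> 'o \<Rightarrow> 'o \<Rightarrow> 'u set" where
  "hom_set \<iota> C x y = \<iota> ` hom C x y"

text \<open>The map of hom-sets induced by a map \<open>\<phi>\<close> of arrows, conjugated by the encoding.\<close>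

definition hom_map ::
    "('m \<Rightarrow> 'u) \<Rightarrow> ('o, 'm) category \<Rightarrow> 'o \<times> 'o \<Rightarrow> 'o \<times> 'o \<Rightarrow> ('m \<Rightarrow> 'm) \<Rightarrow>
     ('u set, 'u \<Rightarrow> 'u) morph" where
  "hom_map \<iota> C = (\<lambda>(x, y) (x', y') \<phi>.
     Morph (hom_set \<iota> C x y)
       (\<lambda>u \<in> hom_set \<iota> C x y. \<iota> (\<phi> (inv_into (Arr C) \<iota> u)))
       (hom_set \<iota> C x' y'))"

definition yoneda_presheaf ::
    "('m \<Rightarrow> 'u) \<Rightarrow> ('o, 'm) category \<Rightarrow> 'o \<Rightarrow> ('o, 'm, 'u) presheaf" where
  "yoneda_presheaf \<iota> C e =
    \<lparr>omap = (\<lambda>x \<in> Obj C. hom_set \<iota> C x e),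
     amap = (\<lambda>f \<in> Arr C. hom_map \<iota> C (Cod C f, e) (Dom C f, e) (\<lambda>h. Comp C h f))\<rparr>"

definition yoneda ::
    "('m \<Rightarrow> 'u) \<Rightarrow> ('o, 'm) category \<Rightarrow>
     ('o, 'm, ('o, 'm, 'u) presheaf, ('o, 'm, 'u) presheaf_arrow) func" where
  "yoneda \<iota> C =
    \<lparr>omap = yoneda_presheaf \<iota> C,
     amap = (\<lambda>g. Morph (yoneda_presheaf \<iota> C (Dom C g))
       (\<lambda>x \<in> Obj C. hom_map \<iota> C (x, Dom C g) (x, Cod C g) (\<lambda>h. Comp C g h))
       (yoneda_presheaf \<iota> C (Cod C g)))\<rparr>"


section \<open>Representable behavior-code factorizations\<close>

definition rep_behavior_code_factorization ::
    "('m \<Rightarrow> 'u) \<Rightarrow> ('o, 'm) category \<Rightarrow> ('b, 'n) category \<Rightarrow> ('o, 'm, 'b, 'n) func \<Rightarrow>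
     ('b, 'n, ('o, 'm, 'u) presheaf, ('o, 'm, 'u) presheaf_arrow) func \<Rightarrow>
     ('o \<Rightarrow> ('o, 'm, 'u) presheaf_arrow) \<Rightarrow> bool" where
  "rep_behavior_code_factorization \<iota> E B p C \<alpha> \<longleftrightarrow>
     is_functor B (presheaf_cat E) C \<and>
     natural_isomorphism E (presheaf_cat E) (yoneda \<iota> E) (func_comp C p) \<alpha>"

definition admits_rep_behavior_code_factorization ::
    "('m \<Rightarrow> 'u) \<Rightarrow> ('o, 'm) category \<Rightarrow> ('b, 'n) category \<Rightarrow> ('o, 'm, 'b, 'n) func \<Rightarrow> bool" where
  "admits_rep_behavior_code_factorization \<iota> E B p \<longleftrightarrow>
     (\<exists>C \<alpha>. rep_behavior_code_factorization \<iota> E B p C \<alpha>)"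

end

theory Submission imports Defs begin

text \<open>The Yoneda embedding is fully faithful, and the conclusions hold for any such functor.
  Suppose a fully faithful functor \<open>Y\<close> is naturally isomorphic to a composite \<open>G \<circ> p\<close>. Then \<open>p\<close>
  cannot forget anything that \<open>Y\<close> remembers. If \<open>p f = p g\<close> for parallel arrows, then
  \<open>G (p f) = G (p g)\<close>, and conjugating with the components of the natural isomorphism gives
  \<open>Y f = Y g\<close>, so \<open>f = g\<close> since \<open>Y\<close> is faithful. If \<open>p e\<close> and \<open>p e'\<close> are isomorphic, then so are
  \<open>G (p e)\<close> and \<open>G (p e')\<close>, hence \<open>Y e\<close> and \<open>Y e'\<close>, and a fully faithful functor reflects this to
  \<open>e\<close> and \<open>e'\<close>. Objects with equal images are the special case of an identity isomorphism.

  The abstract argument is carried by \<open>faithful_if_nat_iso_comp\<close> and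
  \<open>isomorphic_if_nat_iso_comp\<close>. It takes place in a category, so presheaves have to be shown to form
  one (\<open>category_presheaf_cat\<close>), and the Yoneda lemma enters as \<open>is_functor_yoneda\<close>,
  \<open>faithful_yoneda\<close> and \<open>full_yoneda\<close>.\<close>

section \<open>Isomorphisms and fully faithful functors\<close>

definition full :: "('o, 'm) category \<Rightarrow> ('p, 'n) category \<Rightarrow> ('o, 'm, 'p, 'n) func \<Rightarrow> bool" where
  "full C D F \<longleftrightarrow> (\<forall>x \<in> Obj C. \<forall>y \<in> Obj C. \<forall>g \<in> hom D (omap F x) (omap F y).
     \<exists>f \<in> hom C x y. amap F f = g)"

lemma (in category) hom_Obj: "f \<in> hom C x y \<Longrightarrow> x \<in> Obj C \<and> y \<in> Obj C"
  using Dom_in_Obj Cod_in_Obj by (auto simp: hom_def)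

lemma functor_hom:
  "\<lbrakk>is_functor C D F; f \<in> hom C x y\<rbrakk> \<Longrightarrow> amap F f \<in> hom D (omap F x) (omap F y)"
  by (auto simp: is_functor_def hom_def)

lemma functor_Obj: "\<lbrakk>is_functor C D F; x \<in> Obj C\<rbrakk> \<Longrightarrow> omap F x \<in> Obj D"
  by (auto simp: is_functor_def)

lemma functor_Ident:
  "\<lbrakk>is_functor C D F; x \<in> Obj C\<rbrakk> \<Longrightarrow> amap F (Ident C x) = Ident D (omap F x)"
  by (auto simp: is_functor_def)

lemma functor_Comp:
  "\<lbrakk>is_functor C D F; f \<in> hom C x y; g \<in> hom C y z\<rbrakk>
    \<Longrightarrow> amap F (Comp C g f) = Comp D (amap F g) (amap F f)"
  by (auto simp: is_functor_def hom_def)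

lemma nat_trans_square:
  "\<lbrakk>natural_transformation C D F G \<eta>; f \<in> hom C x y\<rbrakk>
    \<Longrightarrow> Comp D (amap G f) (\<eta> x) = Comp D (\<eta> y) (amap F f)"
  by (auto simp: natural_transformation_def hom_def)

lemma (in category) isomorphic_refl: "x \<in> Obj C \<Longrightarrow> isomorphic C x x"
  using Ident_in_hom Comp_Ident_left unfolding isomorphic_def iso_in_def by blast

lemma isomorphic_sym: "isomorphic C x y \<Longrightarrow> isomorphic C y x"
  unfolding isomorphic_def iso_in_def by blast

lemma (in category) Comp_inverse:
  assumes f: "f \<in> hom C x y" and g: "g \<in> hom C y z"
    and f': "f' \<in> hom C y x" and g': "g' \<in> hom C z y"
    and ff: "Comp C f' f = Ident C x" and gg: "Comp C g' g = Ident C y"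
  shows "Comp C (Comp C f' g') (Comp C g f) = Ident C x"
proof -
  have "Comp C (Comp C f' g') (Comp C g f) = Comp C f' (Comp C (Comp C g' g) f)"
    using Comp_assoc[OF Comp_in_hom[OF f g] g' f'] Comp_assoc[OF f g g'] by simp
  then show ?thesis
    using gg ff Comp_Ident_left[OF f] by simp
qed

lemma (in category) isomorphic_trans:
  assumes "isomorphic C x y" "isomorphic C y z"
  shows "isomorphic C x z"
proof -
  obtain f f' where f: "f \<in> hom C x y" "f' \<in> hom C y x"
      "Comp C f' f = Ident C x" "Comp C f f' = Ident C y"
    using assms(1) unfolding isomorphic_def iso_in_def by blast
  obtain g g' where g: "g \<in> hom C y z" "g' \<in> hom C z y"
      "Comp C g' g = Ident C y" "Comp C g g' = Ident C z"
    using assms(2) unfolding isomorphic_def iso_in_def by blast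
  have "iso_in C x z (Comp C g f)"
    unfolding iso_in_def
    using Comp_in_hom[OF f(1) g(1)] Comp_in_hom[OF g(2) f(2)]
      Comp_inverse[OF f(1) g(1) f(2) g(2) f(3) g(3)]
      Comp_inverse[OF g(2) f(2) g(1) f(1) g(4) f(4)] by blast
  then show ?thesis
    using assms unfolding isomorphic_def by blast
qed

lemma (in category) iso_left_cancel:
  assumes a: "iso_in C y z a" and f: "f \<in> hom C x y" and g: "g \<in> hom C x y"
    and eq: "Comp C a f = Comp C a g"
  shows "f = g"
proof -
  obtain b where b: "a \<in> hom C y z" "b \<in> hom C z y" "Comp C b a = Ident C y"
    using a unfolding iso_in_def by blast
  have "f = Comp C b (Comp C a f)"
    using Comp_assoc[OF f b(1,2)] b(3) Comp_Ident_left[OF f] by simp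
  also have "\<dots> = g"
    unfolding eq using Comp_assoc[OF g b(1,2)] b(3) Comp_Ident_left[OF g] by simp
  finally show ?thesis .
qed

lemma functor_preserves_isomorphic:
  assumes F: "is_functor C D F" and iso: "isomorphic C x y"
  shows "isomorphic D (omap F x) (omap F y)"
proof -
  obtain f g where fg: "f \<in> hom C x y" "g \<in> hom C y x"
      "Comp C g f = Ident C x" "Comp C f g = Ident C y" and xy: "x \<in> Obj C" "y \<in> Obj C"
    using iso unfolding isomorphic_def iso_in_def by blast
  have "Comp D (amap F g) (amap F f) = Ident D (omap F x)"
       "Comp D (amap F f) (amap F g) = Ident D (omap F y)"
    using functor_Comp[OF F fg(1,2)] functor_Comp[OF F fg(2,1)] fg(3,4) functor_Ident[OF F] xy
    by auto
  then show ?thesis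
    unfolding isomorphic_def iso_in_def
    using functor_hom[OF F fg(1)] functor_hom[OF F fg(2)] functor_Obj[OF F] xy by blast
qed

text \<open>Fullness lifts an isomorphism and its inverse to arrows \<open>f\<close> and \<open>g\<close>. Their composites have the
  same images as identities, so by faithfulness they are identities.\<close>

lemma fully_faithful_reflects_isomorphic:
  assumes C: "category C" and F: "is_functor C D F"
    and faithful: "faithful C F" and full: "full C D F"
    and x: "x \<in> Obj C" and y: "y \<in> Obj C"
    and iso: "isomorphic D (omap F x) (omap F y)"
  shows "isomorphic C x y"
proof -
  interpret category C by (fact C)
  obtain u v where uv: "u \<in> hom D (omap F x) (omap F y)" "v \<in> hom D (omap F y) (omap F x)"
      "Comp D v u = Ident D (omap F x)" "Comp D u v = Ident D (omap F y)"
    using iso unfolding isomorphic_def iso_in_def by blast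
  obtain f where f: "f \<in> hom C x y" "amap F f = u"
    using full x y uv(1) unfolding full_def by blast
  obtain g where g: "g \<in> hom C y x" "amap F g = v"
    using full x y uv(2) unfolding full_def by blast
  have inj: "inj_on (amap F) (hom C x x)" "inj_on (amap F) (hom C y y)"
    using faithful x y unfolding faithful_def by auto
  have "Comp C g f = Ident C x"
    by (rule inj_onD[OF inj(1)])
      (use functor_Comp[OF F f(1) g(1)] functor_Ident[OF F x] f g uv
        Comp_in_hom[OF f(1) g(1)] Ident_in_hom[OF x] in auto)
  moreover have "Comp C f g = Ident C y"
    by (rule inj_onD[OF inj(2)])
      (use functor_Comp[OF F g(1) f(1)] functor_Ident[OF F y] f g uv
        Comp_in_hom[OF g(1) f(1)] Ident_in_hom[OF y] in auto)
  ultimately show ?thesis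
    unfolding isomorphic_def iso_in_def using f(1) g(1) x y by blast
qed

section \<open>Functors that factor a fully faithful functor\<close>

text \<open>By naturality \<open>Y f\<close> is determined by \<open>G (p f)\<close> up to composition with components of \<open>\<alpha>\<close>, and
  these can be cancelled.\<close>

lemma faithful_if_nat_iso_comp:
  assumes D: "category D" and Y: "is_functor E D Y" and faithful: "faithful E Y"
    and \<alpha>: "natural_isomorphism E D Y (func_comp G p) \<alpha>"
  shows "faithful E p"
  unfolding faithful_def
proof (intro ballI inj_onI)
  fix x y f g
  assume x: "x \<in> Obj E" and y: "y \<in> Obj E" and f: "f \<in> hom E x y" and g: "g \<in> hom E x y"
    and eq: "amap p f = amap p g"
  have nat: "natural_transformation E D Y (func_comp G p) \<alpha>"
    and iso: "iso_in D (omap Y y) (omap (func_comp G p) y) (\<alpha> y)"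
    using \<alpha> y unfolding natural_isomorphism_def by auto
  have "Comp D (\<alpha> y) (amap Y f) = Comp D (\<alpha> y) (amap Y g)"
    using nat_trans_square[OF nat f] nat_trans_square[OF nat g] eq by (simp add: func_comp_def)
  then have "amap Y f = amap Y g"
    using category.iso_left_cancel[OF D iso functor_hom[OF Y f] functor_hom[OF Y g]] by blast
  then show "f = g"
    using faithful x y f g unfolding faithful_def by (blast dest: inj_onD)
qed

lemma isomorphic_if_nat_iso_comp:
  assumes E: "category E" and D: "category D"
    and Y: "is_functor E D Y" and faithful: "faithful E Y" and full: "full E D Y"
    and p: "is_functor E B p" and G: "is_functor B D G"
    and \<alpha>: "natural_isomorphism E D Y (func_comp G p) \<alpha>"
    and x: "x \<in> Obj E" and y: "y \<in> Obj E" and iso: "isomorphic B (omap p x) (omap p y)"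
  shows "isomorphic E x y"
proof -
  have comp: "isomorphic D (omap Y z) (omap G (omap p z))" if z: "z \<in> Obj E" for z
  proof -
    have "iso_in D (omap Y z) (omap G (omap p z)) (\<alpha> z)"
      using \<alpha> z unfolding natural_isomorphism_def func_comp_def by auto
    then show ?thesis
      unfolding isomorphic_def
      using functor_Obj[OF Y z] functor_Obj[OF G functor_Obj[OF p z]] by blast
  qed
  have "isomorphic D (omap Y x) (omap G (omap p y))"
    using category.isomorphic_trans[OF D comp[OF x] functor_preserves_isomorphic[OF G iso]] .
  then have "isomorphic D (omap Y x) (omap Y y)"
    using category.isomorphic_trans[OF D _ isomorphic_sym[OF comp[OF y]]] by blast
  then show ?thesis
    using fully_faithful_reflects_isomorphic[OF E Y faithful full x y] by blast
qed

section \<open>Presheaves form a category\<close>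

lemma set_cat_hom:
  "m \<in> hom set_cat A B \<longleftrightarrow> msrc m = A \<and> mtgt m = B \<and> mmap m \<in> A \<rightarrow>\<^sub>E B"
  by (auto simp: hom_def set_cat_def)

lemma category_set_cat: "category set_cat"
proof
  fix w x y z :: "'a set" and f g h :: "('a set, 'a \<Rightarrow> 'a) morph"
  show "f \<in> Arr set_cat \<Longrightarrow> Dom set_cat f \<in> Obj set_cat"
    "f \<in> Arr set_cat \<Longrightarrow> Cod set_cat f \<in> Obj set_cat"
    by (auto simp: set_cat_def)
  show "x \<in> Obj set_cat \<Longrightarrow> Ident set_cat x \<in> hom set_cat x x"
    by (auto simp: set_cat_def hom_def)
  show "\<lbrakk>f \<in> hom set_cat x y; g \<in> hom set_cat y z\<rbrakk> \<Longrightarrow> Comp set_cat g f \<in> hom set_cat x z"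
    by (auto simp: set_cat_def hom_def compose_def PiE_iff)
  show "f \<in> hom set_cat x y \<Longrightarrow> Comp set_cat f (Ident set_cat x) = f"
    by (cases f) (auto simp: set_cat_def hom_def compose_def PiE_iff extensional_def fun_eq_iff)
  show "f \<in> hom set_cat x y \<Longrightarrow> Comp set_cat (Ident set_cat y) f = f"
    by (cases f) (auto simp: set_cat_def hom_def compose_def PiE_iff extensional_def fun_eq_iff)
  show "\<lbrakk>f \<in> hom set_cat w x; g \<in> hom set_cat x y; h \<in> hom set_cat y z\<rbrakk>
      \<Longrightarrow> Comp set_cat h (Comp set_cat g f) = Comp set_cat (Comp set_cat h g) f"
    by (auto simp: set_cat_def hom_def compose_def PiE_iff fun_eq_iff)
qed

lemma hom_op_cat: "hom (op_cat C) x y = hom C y x"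
  by (auto simp: hom_def op_cat_def)

lemma category_op_cat:
  assumes "category C"
  shows "category (op_cat C)"
proof -
  interpret category C by (fact assms)
  show ?thesis
  proof (unfold_locales, unfold hom_op_cat)
    show "Comp (op_cat C) h (Comp (op_cat C) g f) = Comp (op_cat C) (Comp (op_cat C) h g) f"
      if "f \<in> hom C x w" "g \<in> hom C y x" "h \<in> hom C z y" for f g h w x y z
      using Comp_assoc[OF that(3,2,1)] by (simp add: op_cat_def)
  qed (simp_all add: op_cat_def Dom_in_Obj Cod_in_Obj Ident_in_hom Comp_in_hom
      Comp_Ident_left Comp_Ident_right)
qed

lemma nat_trans_component:
  "\<lbrakk>natural_transformation C D F G \<eta>; x \<in> Obj C\<rbrakk> \<Longrightarrow> \<eta> x \<in> hom D (omap F x) (omap G x)"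
  by (auto simp: natural_transformation_def)

lemma natural_transformation_restrict:
  assumes "category C"
  shows "natural_transformation C D F G (restrict \<eta> (Obj C)) \<longleftrightarrow> natural_transformation C D F G \<eta>"
  using category.Dom_in_Obj[OF assms] category.Cod_in_Obj[OF assms]
  by (auto simp: natural_transformation_def)

lemma natural_transformation_Ident:
  assumes D: "category D" and F: "is_functor C D F"
  shows "natural_transformation C D F F (\<lambda>x. Ident D (omap F x))"
  unfolding natural_transformation_def
proof (intro conjI ballI)
  fix x assume "x \<in> Obj C"
  then show "Ident D (omap F x) \<in> hom D (omap F x) (omap F x)"
    using category.Ident_in_hom[OF D] functor_Obj[OF F] by blast
next
  fix f assume "f \<in> Arr C"
  then have "amap F f \<in> hom D (omap F (Dom C f)) (omap F (Cod C f))"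
    using functor_hom[OF F] by (simp add: hom_def)
  then show "Comp D (amap F f) (Ident D (omap F (Dom C f)))
      = Comp D (Ident D (omap F (Cod C f))) (amap F f)"
    using category.Comp_Ident_left[OF D] category.Comp_Ident_right[OF D] by metis
qed

text \<open>Naturality squares can be pasted side by side.\<close>

lemma natural_transformation_Comp:
  assumes C: "category C" and D: "category D"
    and F: "is_functor C D F" and G: "is_functor C D G" and H: "is_functor C D H"
    and \<eta>: "natural_transformation C D F G \<eta>" and \<theta>: "natural_transformation C D G H \<theta>"
  shows "natural_transformation C D F H (\<lambda>x. Comp D (\<theta> x) (\<eta> x))"
  unfolding natural_transformation_def
proof (intro conjI ballI)
  fix x assume "x \<in> Obj C"
  then show "Comp D (\<theta> x) (\<eta> x) \<in> hom D (omap F x) (omap H x)"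
    using category.Comp_in_hom[OF D] nat_trans_component[OF \<eta>] nat_trans_component[OF \<theta>] by blast
next
  fix f assume "f \<in> Arr C"
  define x y where "x = Dom C f" and "y = Cod C f"
  have f: "f \<in> hom C x y"
    using \<open>f \<in> Arr C\<close> by (simp add: hom_def x_def y_def)
  have xy: "x \<in> Obj C" "y \<in> Obj C"
    using category.hom_Obj[OF C f] by auto
  note a = nat_trans_component[OF \<eta>] nat_trans_component[OF \<theta>]
  have "Comp D (amap H f) (Comp D (\<theta> x) (\<eta> x)) = Comp D (Comp D (\<theta> y) (amap G f)) (\<eta> x)"
    using category.Comp_assoc[OF D a(1)[OF xy(1)] a(2)[OF xy(1)] functor_hom[OF H f]]
      nat_trans_square[OF \<theta> f] by simp
  also have "\<dots> = Comp D (\<theta> y) (Comp D (\<eta> y) (amap F f))"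
    using category.Comp_assoc[OF D a(1)[OF xy(1)] functor_hom[OF G f] a(2)[OF xy(2)]]
      nat_trans_square[OF \<eta> f] by simp
  also have "\<dots> = Comp D (Comp D (\<theta> y) (\<eta> y)) (amap F f)"
    using category.Comp_assoc[OF D functor_hom[OF F f] a(1)[OF xy(2)] a(2)[OF xy(2)]] by simp
  finally show "Comp D (amap H f) (Comp D (\<theta> (Dom C f)) (\<eta> (Dom C f)))
      = Comp D (Comp D (\<theta> (Cod C f)) (\<eta> (Cod C f))) (amap F f)"
    by (simp add: x_def y_def)
qed

lemma Obj_functor_cat:
  "F \<in> Obj (functor_cat C D) \<longleftrightarrow>
    is_functor C D F \<and> omap F \<in> extensional (Obj C) \<and> amap F \<in> extensional (Arr C)"
  by (simp add: functor_cat_def)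

lemma hom_functor_cat:
  "m \<in> hom (functor_cat C D) F G \<longleftrightarrow>
    F \<in> Obj (functor_cat C D) \<and> G \<in> Obj (functor_cat C D) \<and> msrc m = F \<and> mtgt m = G \<and>
    mmap m \<in> extensional (Obj C) \<and> natural_transformation C D F G (mmap m)"
  by (auto simp: functor_cat_def hom_def)

lemma Ident_functor_cat:
  "Ident (functor_cat C D) F = Morph F (\<lambda>x \<in> Obj C. Ident D (omap F x)) F"
  by (simp add: functor_cat_def)

lemma Comp_functor_cat:
  "Comp (functor_cat C D) n m =
    Morph (msrc m) (\<lambda>x \<in> Obj C. Comp D (mmap n x) (mmap m x)) (mtgt n)"
  by (simp add: functor_cat_def)

lemma functor_cat_arrow_eqI:
  assumes "m \<in> hom (functor_cat C D) F G" "n \<in> hom (functor_cat C D) F G"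
    and "\<And>x. x \<in> Obj C \<Longrightarrow> mmap m x = mmap n x"
  shows "m = n"
  using assms by (auto simp: hom_functor_cat intro: morph.expand extensionalityI)

lemma category_functor_cat:
  assumes C: "category C" and D: "category D"
  shows "category (functor_cat C D)"
proof
  interpret D: category D by (fact D)
  let ?P = "functor_cat C D"
  note component = nat_trans_component
  show "Dom ?P f \<in> Obj ?P" "Cod ?P f \<in> Obj ?P" if "f \<in> Arr ?P" for f
    using that by (auto simp: functor_cat_def)
  show Ident: "Ident ?P F \<in> hom ?P F F" if "F \<in> Obj ?P" for F
    using that natural_transformation_Ident[OF D, of C F]
    by (simp add: hom_functor_cat Ident_functor_cat Obj_functor_cat
        natural_transformation_restrict[OF C])
  show Comp: "Comp ?P n m \<in> hom ?P F H" if "m \<in> hom ?P F G" "n \<in> hom ?P G H" for F G H m n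
    using that natural_transformation_Comp[OF C D, of F G H "mmap m" "mmap n"]
    by (simp add: hom_functor_cat Comp_functor_cat Obj_functor_cat
        natural_transformation_restrict[OF C])
  show "Comp ?P m (Ident ?P F) = m" if m: "m \<in> hom ?P F G" for F G m
  proof -
    have id: "Ident ?P F \<in> hom ?P F F"
      using Ident m by (simp add: hom_functor_cat)
    show ?thesis
    proof (rule functor_cat_arrow_eqI[OF Comp[OF id m] m])
      fix x assume x: "x \<in> Obj C"
      have "mmap m x \<in> hom D (omap F x) (omap G x)"
        using m component[OF _ x] by (auto simp: hom_functor_cat)
      then show "mmap (Comp ?P m (Ident ?P F)) x = mmap m x"
        using x by (simp add: Comp_functor_cat Ident_functor_cat D.Comp_Ident_right)
    qed
  qed
  show "Comp ?P (Ident ?P G) m = m" if m: "m \<in> hom ?P F G" for F G m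
  proof -
    have id: "Ident ?P G \<in> hom ?P G G"
      using Ident m by (simp add: hom_functor_cat)
    show ?thesis
    proof (rule functor_cat_arrow_eqI[OF Comp[OF m id] m])
      fix x assume x: "x \<in> Obj C"
      have "mmap m x \<in> hom D (omap F x) (omap G x)"
        using m component[OF _ x] by (auto simp: hom_functor_cat)
      then show "mmap (Comp ?P (Ident ?P G) m) x = mmap m x"
        using x by (simp add: Comp_functor_cat Ident_functor_cat D.Comp_Ident_left)
    qed
  qed
  show "Comp ?P k (Comp ?P n m) = Comp ?P (Comp ?P k n) m"
    if m: "m \<in> hom ?P F G" and n: "n \<in> hom ?P G H" and k: "k \<in> hom ?P H K" for F G H K m n k
  proof (rule functor_cat_arrow_eqI[OF Comp[OF Comp[OF m n] k] Comp[OF m Comp[OF n k]]])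
    fix x assume x: "x \<in> Obj C"
    have "mmap m x \<in> hom D (omap F x) (omap G x)" "mmap n x \<in> hom D (omap G x) (omap H x)"
      "mmap k x \<in> hom D (omap H x) (omap K x)"
      using m n k component[OF _ x] by (auto simp: hom_functor_cat)
    from D.Comp_assoc[OF this] show "mmap (Comp ?P k (Comp ?P n m)) x
        = mmap (Comp ?P (Comp ?P k n) m) x"
      using x by (simp add: Comp_functor_cat)
  qed
qed

lemma category_presheaf_cat: "category C \<Longrightarrow> category (presheaf_cat C)"
  unfolding presheaf_cat_def by (intro category_functor_cat category_op_cat category_set_cat)

section \<open>The Yoneda embedding is fully faithful\<close>

text \<open>The presheaves take values in the encoded hom-sets. Since \<open>\<iota>\<close> is injective, the rules for
  \<open>hom_map\<close> below reduce every computation with them to one with the arrows of \<open>C\<close>.\<close>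

locale encoded_category = category C for C :: "('o, 'm) category" +
  fixes \<iota> :: "'m \<Rightarrow> 'u"
  assumes inj_encoding: "inj_on \<iota> (Arr C)"
begin

lemma decode: "f \<in> hom C x y \<Longrightarrow> inv_into (Arr C) \<iota> (\<iota> f) = f"
  using inj_encoding by (simp add: hom_def)

lemma mmap_hom_map:
  "f \<in> hom C x y \<Longrightarrow> mmap (hom_map \<iota> C (x, y) q \<phi>) (\<iota> f) = \<iota> (\<phi> f)"
  by (cases q) (simp add: hom_map_def hom_set_def decode)

lemma hom_map_cong:
  "(\<And>f. f \<in> hom C x y \<Longrightarrow> \<phi> f = \<psi> f) \<Longrightarrow> hom_map \<iota> C (x, y) q \<phi> = hom_map \<iota> C (x, y) q \<psi>"
  by (cases q) (auto simp: hom_map_def hom_set_def decode fun_eq_iff)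

lemma hom_map_in_hom:
  assumes "\<And>f. f \<in> hom C x y \<Longrightarrow> \<phi> f \<in> hom C x' y'"
  shows "hom_map \<iota> C (x, y) (x', y') \<phi> \<in> hom set_cat (hom_set \<iota> C x y) (hom_set \<iota> C x' y')"
  using assms by (auto simp: hom_map_def hom_set_def set_cat_hom decode)

lemma hom_map_Ident:
  "hom_map \<iota> C (x, y) (x, y) (\<lambda>f. f) = Ident set_cat (hom_set \<iota> C x y)"
  by (auto simp: hom_map_def hom_set_def set_cat_def decode fun_eq_iff)

lemma hom_map_Comp:
  assumes "\<And>f. f \<in> hom C x y \<Longrightarrow> \<phi> f \<in> hom C x' y'"
  shows "Comp set_cat (hom_map \<iota> C (x', y') (x'', y'') \<psi>) (hom_map \<iota> C (x, y) (x', y') \<phi>)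
    = hom_map \<iota> C (x, y) (x'', y'') (\<lambda>f. \<psi> (\<phi> f))"
  using assms
  by (auto simp: hom_map_def hom_set_def set_cat_def compose_def decode fun_eq_iff)
    (metis assms decode)

lemma omap_yoneda_presheaf: "x \<in> Obj C \<Longrightarrow> omap (yoneda_presheaf \<iota> C e) x = hom_set \<iota> C x e"
  by (simp add: yoneda_presheaf_def)

lemma amap_yoneda_presheaf:
  "f \<in> hom C x y \<Longrightarrow>
    amap (yoneda_presheaf \<iota> C e) f = hom_map \<iota> C (y, e) (x, e) (\<lambda>h. Comp C h f)"
  by (auto simp: yoneda_presheaf_def hom_def)

lemma is_functor_yoneda_presheaf: "is_functor (op_cat C) set_cat (yoneda_presheaf \<iota> C e)"
  (is "is_functor _ _ ?Y")
  unfolding is_functor_def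
proof (intro conjI ballI impI)
  show "omap ?Y x \<in> Obj set_cat" for x
    by (simp add: set_cat_def)
next
  fix f assume "f \<in> Arr (op_cat C)"
  then have f: "f \<in> hom C (Dom C f) (Cod C f)"
    by (simp add: hom_def op_cat_def)
  then show "amap ?Y f \<in> hom set_cat (omap ?Y (Dom (op_cat C) f)) (omap ?Y (Cod (op_cat C) f))"
    using hom_map_in_hom[OF Comp_in_hom[OF f]] hom_Obj[OF f]
    by (simp add: amap_yoneda_presheaf[OF f] omap_yoneda_presheaf op_cat_def)
next
  fix x assume "x \<in> Obj (op_cat C)"
  then have x: "x \<in> Obj C" by (simp add: op_cat_def)
  have "hom_map \<iota> C (x, e) (x, e) (\<lambda>h. Comp C h (Ident C x))
      = hom_map \<iota> C (x, e) (x, e) (\<lambda>h. h)"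
    by (rule hom_map_cong) (rule Comp_Ident_right)
  then show "amap ?Y (Ident (op_cat C) x) = Ident set_cat (omap ?Y x)"
    using x by (simp add: op_cat_def amap_yoneda_presheaf[OF Ident_in_hom[OF x]]
        omap_yoneda_presheaf hom_map_Ident)
next
  fix f g assume fg: "f \<in> Arr (op_cat C)" "g \<in> Arr (op_cat C)" "Dom (op_cat C) g = Cod (op_cat C) f"
  define x y z where "x = Dom C g" and "y = Dom C f" and "z = Cod C f"
  have g: "g \<in> hom C x y" and f: "f \<in> hom C y z"
    using fg by (auto simp: hom_def op_cat_def x_def y_def z_def)
  have "Comp set_cat (amap ?Y g) (amap ?Y f)
      = hom_map \<iota> C (z, e) (x, e) (\<lambda>h. Comp C (Comp C h f) g)"
    using hom_map_Comp[OF Comp_in_hom[OF f]]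
    by (simp add: amap_yoneda_presheaf[OF f] amap_yoneda_presheaf[OF g])
  also have "\<dots> = hom_map \<iota> C (z, e) (x, e) (\<lambda>h. Comp C h (Comp C f g))"
    by (rule hom_map_cong) (rule Comp_assoc[OF g f, symmetric])
  finally show "amap ?Y (Comp (op_cat C) g f) = Comp set_cat (amap ?Y g) (amap ?Y f)"
    by (simp add: op_cat_def amap_yoneda_presheaf[OF Comp_in_hom[OF g f]])
qed

lemma yoneda_presheaf_in_Obj: "yoneda_presheaf \<iota> C e \<in> Obj (presheaf_cat C)"
  using is_functor_yoneda_presheaf[of e]
  by (simp add: presheaf_cat_def Obj_functor_cat yoneda_presheaf_def op_cat_def)

lemma omap_yoneda: "omap (yoneda \<iota> C) e = yoneda_presheaf \<iota> C e"
  by (simp add: yoneda_def)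

lemma mmap_amap_yoneda:
  "\<lbrakk>g \<in> hom C e e'; x \<in> Obj C\<rbrakk> \<Longrightarrow>
    mmap (amap (yoneda \<iota> C) g) x = hom_map \<iota> C (x, e) (x, e') (\<lambda>h. Comp C g h)"
  by (auto simp: yoneda_def hom_def)

text \<open>Postcomposition with \<open>g\<close> is natural because it commutes with precomposition, by
  associativity.\<close>

lemma amap_yoneda_in_hom:
  assumes g: "g \<in> hom C e e'"
  shows "amap (yoneda \<iota> C) g \<in>
    hom (presheaf_cat C) (yoneda_presheaf \<iota> C e) (yoneda_presheaf \<iota> C e')"
proof -
  let ?\<eta> = "mmap (amap (yoneda \<iota> C) g)"
  have "natural_transformation (op_cat C) set_cat
      (yoneda_presheaf \<iota> C e) (yoneda_presheaf \<iota> C e') ?\<eta>"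
    unfolding natural_transformation_def
  proof (intro conjI ballI)
    fix x assume "x \<in> Obj (op_cat C)"
    then have x: "x \<in> Obj C" by (simp add: op_cat_def)
    show "?\<eta> x \<in> hom set_cat
        (omap (yoneda_presheaf \<iota> C e) x) (omap (yoneda_presheaf \<iota> C e') x)"
      unfolding mmap_amap_yoneda[OF g x] omap_yoneda_presheaf[OF x]
      by (rule hom_map_in_hom) (rule Comp_in_hom[OF _ g])
  next
    fix f assume "f \<in> Arr (op_cat C)"
    define x y where "x = Dom C f" and "y = Cod C f"
    have f: "f \<in> hom C x y"
      using \<open>f \<in> Arr (op_cat C)\<close> by (simp add: hom_def op_cat_def x_def y_def)
    have xy: "x \<in> Obj C" "y \<in> Obj C" using hom_Obj[OF f] by auto
    have "Comp set_cat (amap (yoneda_presheaf \<iota> C e') f) (?\<eta> y)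
        = hom_map \<iota> C (y, e) (x, e') (\<lambda>h. Comp C (Comp C g h) f)"
      unfolding amap_yoneda_presheaf[OF f] mmap_amap_yoneda[OF g xy(2)]
      by (rule hom_map_Comp) (rule Comp_in_hom[OF _ g])
    also have "\<dots> = hom_map \<iota> C (y, e) (x, e') (\<lambda>h. Comp C g (Comp C h f))"
      by (rule hom_map_cong) (rule Comp_assoc[OF f _ g, symmetric])
    also have "\<dots> = Comp set_cat (?\<eta> x) (amap (yoneda_presheaf \<iota> C e) f)"
      unfolding amap_yoneda_presheaf[OF f] mmap_amap_yoneda[OF g xy(1)]
      by (rule hom_map_Comp[symmetric]) (rule Comp_in_hom[OF f])
    finally show "Comp set_cat (amap (yoneda_presheaf \<iota> C e') f) (?\<eta> (Dom (op_cat C) f))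
        = Comp set_cat (?\<eta> (Cod (op_cat C) f)) (amap (yoneda_presheaf \<iota> C e) f)"
      by (simp add: op_cat_def x_def y_def)
  qed
  moreover have "msrc (amap (yoneda \<iota> C) g) = yoneda_presheaf \<iota> C e"
      "mtgt (amap (yoneda \<iota> C) g) = yoneda_presheaf \<iota> C e'"
      "?\<eta> \<in> extensional (Obj (op_cat C))"
    using g by (auto simp: yoneda_def hom_def op_cat_def)
  ultimately show ?thesis
    using yoneda_presheaf_in_Obj unfolding presheaf_cat_def hom_functor_cat by blast
qed

lemma presheaf_arrow_eqI:
  assumes "m \<in> hom (presheaf_cat C) F G" "n \<in> hom (presheaf_cat C) F G"
    and "\<And>x. x \<in> Obj C \<Longrightarrow> mmap m x = mmap n x"
  shows "m = n"
  using functor_cat_arrow_eqI[of m "op_cat C" set_cat F G n] assms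
  by (simp add: presheaf_cat_def op_cat_def)

lemma mmap_Comp_presheaf_cat:
  "x \<in> Obj C \<Longrightarrow>
    mmap (Comp (presheaf_cat C) n m) x = Comp set_cat (mmap n x) (mmap m x)"
  by (simp add: presheaf_cat_def Comp_functor_cat op_cat_def)

lemma mmap_Ident_presheaf_cat:
  "x \<in> Obj C \<Longrightarrow> mmap (Ident (presheaf_cat C) F) x = Ident set_cat (omap F x)"
  by (simp add: presheaf_cat_def Ident_functor_cat op_cat_def)

lemma is_functor_yoneda: "is_functor C (presheaf_cat C) (yoneda \<iota> C)"
  unfolding is_functor_def omap_yoneda
proof (intro conjI ballI impI)
  interpret P: category "presheaf_cat C :: (('o, 'm, 'u) presheaf, ('o, 'm, 'u) presheaf_arrow) category"
    by (rule category_presheaf_cat) (rule category_axioms)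
  show "yoneda_presheaf \<iota> C e \<in> Obj (presheaf_cat C)" for e
    by (rule yoneda_presheaf_in_Obj)
  show "amap (yoneda \<iota> C) f \<in> hom (presheaf_cat C)
      (yoneda_presheaf \<iota> C (Dom C f)) (yoneda_presheaf \<iota> C (Cod C f))" if "f \<in> Arr C" for f
    using that by (intro amap_yoneda_in_hom) (simp add: hom_def)
  show "amap (yoneda \<iota> C) (Ident C e) = Ident (presheaf_cat C) (yoneda_presheaf \<iota> C e)"
    if e: "e \<in> Obj C" for e
  proof (rule presheaf_arrow_eqI[OF amap_yoneda_in_hom[OF Ident_in_hom[OF e]]
        P.Ident_in_hom[OF yoneda_presheaf_in_Obj]])
    fix x assume x: "x \<in> Obj C"
    have "hom_map \<iota> C (x, e) (x, e) (\<lambda>h. Comp C (Ident C e) h)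
        = hom_map \<iota> C (x, e) (x, e) (\<lambda>h. h)"
      by (rule hom_map_cong) (rule Comp_Ident_left)
    then show "mmap (amap (yoneda \<iota> C) (Ident C e)) x
        = mmap (Ident (presheaf_cat C) (yoneda_presheaf \<iota> C e)) x"
      by (simp add: mmap_amap_yoneda[OF Ident_in_hom[OF e] x] mmap_Ident_presheaf_cat[OF x]
          omap_yoneda_presheaf[OF x] hom_map_Ident)
  qed
  fix f g assume fg: "f \<in> Arr C" "g \<in> Arr C" "Dom C g = Cod C f"
  define a b c where "a = Dom C f" and "b = Cod C f" and "c = Cod C g"
  have f: "f \<in> hom C a b" and g: "g \<in> hom C b c"
    using fg by (auto simp: hom_def a_def b_def c_def)
  show "amap (yoneda \<iota> C) (Comp C g f)
      = Comp (presheaf_cat C) (amap (yoneda \<iota> C) g) (amap (yoneda \<iota> C) f)"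
  proof (rule presheaf_arrow_eqI[OF amap_yoneda_in_hom[OF Comp_in_hom[OF f g]]
        P.Comp_in_hom[OF amap_yoneda_in_hom[OF f] amap_yoneda_in_hom[OF g]]])
    fix x assume x: "x \<in> Obj C"
    have "hom_map \<iota> C (x, a) (x, c) (\<lambda>h. Comp C (Comp C g f) h)
        = hom_map \<iota> C (x, a) (x, c) (\<lambda>h. Comp C g (Comp C f h))"
      by (rule hom_map_cong) (rule Comp_assoc[OF _ f g, symmetric])
    also have "\<dots> = Comp set_cat (hom_map \<iota> C (x, b) (x, c) (\<lambda>h. Comp C g h))
        (hom_map \<iota> C (x, a) (x, b) (\<lambda>h. Comp C f h))"
      by (rule hom_map_Comp[symmetric]) (rule Comp_in_hom[OF _ f])
    finally show "mmap (amap (yoneda \<iota> C) (Comp C g f)) x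
        = mmap (Comp (presheaf_cat C) (amap (yoneda \<iota> C) g) (amap (yoneda \<iota> C) f)) x"
      by (simp add: mmap_amap_yoneda[OF Comp_in_hom[OF f g] x] mmap_Comp_presheaf_cat[OF x]
          mmap_amap_yoneda[OF f x] mmap_amap_yoneda[OF g x])
  qed
qed

text \<open>An arrow is recovered from its image by evaluating at the identity.\<close>

lemma faithful_yoneda: "faithful C (yoneda \<iota> C)"
  unfolding faithful_def
proof (intro ballI inj_onI)
  fix e e' f g
  assume e: "e \<in> Obj C" and f: "f \<in> hom C e e'" and g: "g \<in> hom C e e'"
    and eq: "amap (yoneda \<iota> C) f = amap (yoneda \<iota> C) g"
  have eval: "mmap (mmap (amap (yoneda \<iota> C) h) e) (\<iota> (Ident C e)) = \<iota> h"
    if h: "h \<in> hom C e e'" for h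
    by (simp add: mmap_amap_yoneda[OF h e] mmap_hom_map[OF Ident_in_hom[OF e]]
        Comp_Ident_right[OF h])
  have "\<iota> f = \<iota> g"
    using eval[OF f] unfolding eq eval[OF g] by (rule sym)
  then show "f = g"
    by (metis decode[OF f] decode[OF g])
qed

text \<open>A transformation \<open>\<theta>\<close> between representables is postcomposition with the arrow \<open>f\<close> that it
  assigns to the identity: every \<open>h : x \<rightarrow> e\<close> is the restriction of the identity along \<open>h\<close>, so by
  naturality \<open>\<theta>\<close> sends it to the restriction of \<open>f\<close> along \<open>h\<close>.\<close>

lemma full_yoneda: "full C (presheaf_cat C) (yoneda \<iota> C)"
  unfolding full_def omap_yoneda
proof (intro ballI)
  fix e e' \<theta>
  assume e: "e \<in> Obj C"
    and \<theta>: "\<theta> \<in> hom (presheaf_cat C) (yoneda_presheaf \<iota> C e) (yoneda_presheaf \<iota> C e')"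
  have nat: "natural_transformation (op_cat C) set_cat
      (yoneda_presheaf \<iota> C e) (yoneda_presheaf \<iota> C e') (mmap \<theta>)"
    using \<theta> by (simp add: presheaf_cat_def hom_functor_cat)
  have comp: "mmap \<theta> x \<in> hom set_cat (hom_set \<iota> C x e) (hom_set \<iota> C x e')" if "x \<in> Obj C" for x
    using nat_trans_component[OF nat, of x] that
    by (simp add: op_cat_def omap_yoneda_presheaf)
  have id: "Ident C e \<in> hom C e e" by (rule Ident_in_hom[OF e])
  have "mmap (mmap \<theta> e) (\<iota> (Ident C e)) \<in> hom_set \<iota> C e e'"
    using comp[OF e] id by (auto simp: set_cat_hom hom_set_def)
  then obtain f where f: "f \<in> hom C e e'" and \<theta>_id: "mmap (mmap \<theta> e) (\<iota> (Ident C e)) = \<iota> f"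
    by (auto simp: hom_set_def)
  have \<theta>_eq: "mmap (mmap \<theta> x) (\<iota> h) = \<iota> (Comp C f h)" if h: "h \<in> hom C x e" for x h
  proof -
    have "Comp set_cat (amap (yoneda_presheaf \<iota> C e') h) (mmap \<theta> e)
        = Comp set_cat (mmap \<theta> x) (amap (yoneda_presheaf \<iota> C e) h)"
      using nat_trans_square[OF nat, of h e x] h by (simp add: hom_op_cat)
    then have "mmap (Comp set_cat (amap (yoneda_presheaf \<iota> C e') h) (mmap \<theta> e)) (\<iota> (Ident C e))
        = mmap (Comp set_cat (mmap \<theta> x) (amap (yoneda_presheaf \<iota> C e) h)) (\<iota> (Ident C e))"
      by simp
    moreover have "\<iota> (Ident C e) \<in> hom_set \<iota> C e e" "msrc (mmap \<theta> e) = hom_set \<iota> C e e"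
      "msrc (amap (yoneda_presheaf \<iota> C e) h) = hom_set \<iota> C e e"
      using id comp[OF e]
      by (auto simp: hom_set_def set_cat_hom amap_yoneda_presheaf[OF h] hom_map_def)
    ultimately have "mmap (amap (yoneda_presheaf \<iota> C e') h) (\<iota> f)
        = mmap (mmap \<theta> x) (mmap (amap (yoneda_presheaf \<iota> C e) h) (\<iota> (Ident C e)))"
      by (simp add: set_cat_def compose_def \<theta>_id)
    then show ?thesis
      by (simp add: amap_yoneda_presheaf[OF h] mmap_hom_map[OF f] mmap_hom_map[OF id]
          Comp_Ident_left[OF h])
  qed
  have "amap (yoneda \<iota> C) f = \<theta>"
  proof (rule presheaf_arrow_eqI[OF amap_yoneda_in_hom[OF f] \<theta>])
    fix x assume x: "x \<in> Obj C"
    have img: "mmap (amap (yoneda \<iota> C) f) x \<in> hom set_cat (hom_set \<iota> C x e) (hom_set \<iota> C x e')"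
      unfolding mmap_amap_yoneda[OF f x]
      by (rule hom_map_in_hom) (rule Comp_in_hom[OF _ f])
    have "mmap (mmap (amap (yoneda \<iota> C) f) x) u = mmap (mmap \<theta> x) u"
      if "u \<in> hom_set \<iota> C x e" for u
      using that \<theta>_eq by (auto simp: hom_set_def mmap_amap_yoneda[OF f x] mmap_hom_map)
    then have "mmap (mmap (amap (yoneda \<iota> C) f) x) = mmap (mmap \<theta> x)"
      using img comp[OF x] by (auto simp: set_cat_hom intro: PiE_ext)
    then show "mmap (amap (yoneda \<iota> C) f) x = mmap \<theta> x"
      using img comp[OF x] by (auto simp: set_cat_hom intro: morph.expand)
  qed
  then show "\<exists>f \<in> hom C e e'. amap (yoneda \<iota> C) f = \<theta>"
    using f by blast
qed

end

section \<open>Representable behavior-code factorizations\<close>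

theorem theorem14p2:
  fixes E :: "('o, 'm) category"
    and B :: "('b, 'n) category"
    and p :: "('o, 'm, 'b, 'n) func"
    and \<iota> :: "'m \<Rightarrow> 'u"
  assumes "small_category \<iota> E"
    and "category B"
    and "is_functor E B p"
    and "admits_rep_behavior_code_factorization \<iota> E B p"
  shows "faithful E p \<and>
    (\<forall>e \<in> Obj E. \<forall>e' \<in> Obj E. isomorphic B (omap p e) (omap p e') \<longrightarrow> isomorphic E e e') \<and>
    (\<forall>e \<in> Obj E. \<forall>e' \<in> Obj E. \<not> isomorphic E e e' \<longrightarrow> omap p e \<noteq> omap p e')"
proof -
  have E: "category E" and enc: "encoded_category E \<iota>"
    using assms(1)
    by (auto simp: small_category_def encoded_category_def encoded_category_axioms_def)
  obtain G \<alpha> where G: "is_functor B (presheaf_cat E) G"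
    and \<alpha>: "natural_isomorphism E (presheaf_cat E) (yoneda \<iota> E) (func_comp G p) \<alpha>"
    using assms(4)
    unfolding admits_rep_behavior_code_factorization_def rep_behavior_code_factorization_def
    by blast
  note P = category_presheaf_cat[OF E]
    and Y = encoded_category.is_functor_yoneda[OF enc]
    and Y_faithful = encoded_category.faithful_yoneda[OF enc]
    and Y_full = encoded_category.full_yoneda[OF enc]
  have reflect: "isomorphic E e e'"
    if "e \<in> Obj E" "e' \<in> Obj E" "isomorphic B (omap p e) (omap p e')" for e e'
    using isomorphic_if_nat_iso_comp[OF E P Y Y_faithful Y_full assms(3) G \<alpha> that] .
  moreover have "isomorphic E e e'"
    if e: "e \<in> Obj E" and e': "e' \<in> Obj E" and eq: "omap p e = omap p e'" for e e'
    using reflect[OF e e'] category.isomorphic_refl[OF assms(2) functor_Obj[OF assms(3) e]] eq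
    by simp
  ultimately show ?thesis
    using faithful_if_nat_iso_comp[OF P Y Y_faithful \<alpha>] by blast
qed

end
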